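(* Let $\alpha,\beta,\gamma>-1$, $\alpha\ne\beta$, $|\alpha-\beta|<1$. The coefficients of the type II Jacobi–Piñeiro stochastic matrix $P_{II}$ (see context) are given explicitly as follows. For $n\ge0$: $$P_{II,2n,2n+1}=\frac{(\gamma+2n+1)(\alpha+\gamma+2n+1)(\beta+\gamma+2n+1)}{(\alpha+\gamma+3n+1)(\alpha+\gamma+3n+2)(\beta+\gamma+3n+1)},$$ $$P_{II,2n+1,2n+2}=\frac{(\gamma+2n+2)(\alpha+\gamma+2n+2)(\beta+\gamma+2n+2)}{(\alpha+\gamma+3n+3)(\beta+\gamma+3n+2)(\beta+\gamma+3n+3)},$$ $$\begin{aligned}P_{II,2n,2n}={}&\frac{(\alpha+n+1)(\alpha+\gamma+2n+1)(\beta+\gamma+2n+1)}{(\alpha+\gamma+3n+1)(\alpha+\gamma+3n+2)(\beta+\gamma+3n+1)}+\frac{n(\gamma+2n)(\alpha+\gamma+2n+1)}{(\alpha+\gamma+3n+1)(\beta+\gamma+3n)(\beta+\gamma+3n+1)}\\&+\frac{n(\gamma+2n)(\beta+\gamma+2n)}{(\alpha+\gamma+3n)(\alpha+\gamma+3n+1)(\beta+\gamma+3n)},\end{aligned}$$ $$\begin{aligned}P_{II,2n+1,2n+1}={}&-\frac{n(\beta+n)(-\alpha+\beta+n)}{(\beta-\alpha)(\beta+\gamma+3n)}+\frac{n(\beta+n)(-\alpha+\beta+n)(\alpha+\gamma+3n+1)}{(\beta-\alpha)(\alpha-\beta+1)(\beta+\gamma+3n)(\beta+\gamma+3n+1)}\\&-\frac{(n+1)(\alpha+n+1)(\alpha-\beta+n+1)(\beta+\gamma+3n+2)}{(\beta-\alpha)(\alpha-\beta+1)(\alpha+\gamma+3n+2)(\alpha+\gamma+3n+3)}+\frac{(n+1)(\beta+n+1)(-\alpha+\beta+n+1)}{(\beta-\alpha)(\beta+\gamma+3n+3)},\end{aligned}$$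 $$P_{II,2n+1,2n}=\frac{n(\alpha-\beta-n)(\beta+n)(\alpha+\gamma+3n+1)}{(\alpha-\beta+1)(\beta+\gamma+3n)(\beta+\gamma+3n+1)(\beta+\gamma+3n+2)}+\frac{(n+1)(\alpha-\beta+n+1)(\alpha+n+1)}{(\alpha-\beta+1)(\alpha+\gamma+3n+2)(\alpha+\gamma+3n+3)},$$ and for $n\ge1$: $$\begin{aligned}P_{II,2n,2n-1}={}&\frac{n(\alpha-\beta+n)(\gamma+2n-1)}{(\alpha+\gamma+3n-1)(\alpha+\gamma+3n)(\alpha+\gamma+3n+1)}+\frac{n(\beta+n)(\beta+\gamma+2n)}{(\alpha+\gamma+3n)(\alpha+\gamma+3n+1)(\beta+\gamma+3n)}\\&+\frac{n(\beta+n)(\alpha+\gamma+2n+1)}{(\alpha+\gamma+3n+1)(\beta+\gamma+3n)(\beta+\gamma+3n+1)},\end{aligned}$$ $$P_{II,2n,2n-2}=\frac{n(\alpha-\beta+n)(\alpha+n)}{(\alpha+\gamma+3n-1)(\alpha+\gamma+3n)(\alpha+\gamma+3n+1)},$$ $$P_{II,2n+1,2n-1}=\frac{n(-\alpha+\beta+n)(\beta+n)}{(\beta+\gamma+3n)(\beta+\gamma+3n+1)(\beta+\gamma+3n+2)}.$$ For $n=0$, terms with an explicit factor $n$ are understood to be $0$, and common factors of numerators and denominators are understood to be cancelled (e.g. $P_{II,0,1}=\frac{\gamma+1}{\alpha+\gamma+2}$, $P_{II,0,0}=\frac{\alpha+1}{\alpha+\gamma+2}$).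
   Context: The monic Jacobi–Piñeiro multiple orthogonal polynomials of type II $B_{(n,m)}$ are the monic polynomials of degree $n+m$ with $$\int_0^1B_{(n,m)}(x)x^{\alpha+j}(1-x)^\gamma\,dx=0,\ 0\le j\le n-1,\qquad\int_0^1B_{(n,m)}(x)x^{\beta+j}(1-x)^\gamma\,dx=0,\ 0\le j\le m-1.$$ On the step-line put $B^{(2n)}=B_{(n,n)}$ and $B^{(2n+1)}=B_{(n+1,n)}$, $n\in\mathbb N_0$. The Jacobi matrix $J=(J_{k,l})_{k,l\in\mathbb N_0}$ is defined by $xB^{(k)}(x)=\sum_lJ_{k,l}B^{(l)}(x)$. The type II Jacobi–Piñeiro stochastic matrix has entries $$P_{II,k,l}=\frac{B^{(l)}(1)}{B^{(k)}(1)}J_{k,l},$$ which vanish unless $k-2\le l\le k+1$. *)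

theory Defs
  imports "HOL-Analysis.Analysis" "HOL-Computational_Algebra.Polynomial"
begin

text \<open>
  Up to the null set of the endpoints, \<^term>\<open>x powr s\<close> is the usual real power on the
  integration interval. Stating orthogonality with \<^const>\<open>has_integral\<close> includes the
  existence of the integral.
\<close>

definition is_jacobi_pineiro_II ::
    "real \<Rightarrow> real \<Rightarrow> real \<Rightarrow> nat \<Rightarrow> nat \<Rightarrow> real poly \<Rightarrow> bool" where
  "is_jacobi_pineiro_II \<alpha> \<beta> \<gamma> n m p \<longleftrightarrow>
     degree p = n + m \<and> lead_coeff p = 1 \<and>
     (\<forall>j<n. ((\<lambda>x. poly p x * x powr (\<alpha> + real j) * (1 - x) powr \<gamma>) has_integral 0) {0..1}) \<and>
     (\<forall>j<m. ((\<lambda>x. poly p x * x powr (\<beta> + real j) * (1 - x) powr \<gamma>) has_integral 0) {0..1})"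

definition jacobi_pineiro_II :: "real \<Rightarrow> real \<Rightarrow> real \<Rightarrow> nat \<Rightarrow> nat \<Rightarrow> real poly" where
  "jacobi_pineiro_II \<alpha> \<beta> \<gamma> n m = (THE p. is_jacobi_pineiro_II \<alpha> \<beta> \<gamma> n m p)"

definition step_line_poly :: "real \<Rightarrow> real \<Rightarrow> real \<Rightarrow> nat \<Rightarrow> real poly" where
  "step_line_poly \<alpha> \<beta> \<gamma> k =
     (if even k then jacobi_pineiro_II \<alpha> \<beta> \<gamma> (k div 2) (k div 2)
      else jacobi_pineiro_II \<alpha> \<beta> \<gamma> (k div 2 + 1) (k div 2))"

text \<open>
  The Jacobi matrix is the unique row-finite matrix expressing multiplication by the
  variable in the basis of step-line polynomials; row-finiteness is what makes the sum over
  all column indices meaningful.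
\<close>

definition jacobi_matrix :: "real \<Rightarrow> real \<Rightarrow> real \<Rightarrow> nat \<Rightarrow> nat \<Rightarrow> real" where
  "jacobi_matrix \<alpha> \<beta> \<gamma> =
     (THE J. \<forall>k. finite {l. J k l \<noteq> 0} \<and>
        [:0, 1:] * step_line_poly \<alpha> \<beta> \<gamma> k =
          (\<Sum>l\<in>{l. J k l \<noteq> 0}. smult (J k l) (step_line_poly \<alpha> \<beta> \<gamma> l)))"

definition stochastic_matrix_II :: "real \<Rightarrow> real \<Rightarrow> real \<Rightarrow> nat \<Rightarrow> nat \<Rightarrow> real" where
  "stochastic_matrix_II \<alpha> \<beta> \<gamma> k l =
     poly (step_line_poly \<alpha> \<beta> \<gamma> l) 1 / poly (step_line_poly \<alpha> \<beta> \<gamma> k) 1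
       * jacobi_matrix \<alpha> \<beta> \<gamma> k l"

end

theory Submission
  imports Defs
begin

text \<open>
  The Mellin transform \<open>\<integral> p(x) x\<^sup>s (1 - x)\<^sup>\<gamma> dx\<close> of a polynomial \<open>p\<close> of degree at most \<open>N\<close> is
  \<open>\<Gamma>(\<gamma> + 1) \<Gamma>(s + 1) / \<Gamma>(s + \<gamma> + 2 + N)\<close> times a polynomial in \<open>s\<close> of degree at most \<open>N\<close>, and
  this correspondence is a bijection. Orthogonality prescribes all \<open>N\<close> zeros of the transformed
  polynomial, and its leading coefficient is \<open>p(1)\<close>; so \<open>B\<^sup>(\<^sup>k\<^sup>) / B\<^sup>(\<^sup>k\<^sup>)(1)\<close> becomes the monic
  polynomial \<open>R\<^sub>k\<close> with the prescribed zeros. Multiplication by \<open>x\<close> becomes the shift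
  \<open>s \<mapsto> s + 1\<close>, and the recurrence turns into
  \<open>(s + 1) R\<^sub>k(s + 1) = \<Sum>\<^sub>l P\<^sub>k\<^sub>l R\<^sub>l(s) (s + \<gamma> + 2 + l)\<^sub>k\<^sub>+\<^sub>1\<^sub>-\<^sub>l\<close>, with rising factorials, in which exactly the stochastic
  coefficients appear. After cancellation this is an identity between cubic polynomials in \<open>s\<close>.
\<close>

section \<open>The polynomial part of the Mellin transform\<close>

text \<open>The step encodes \<Gamma>(z + 1) = z \<Gamma>(z) at z = s + \<gamma> + 2 + N: old terms
  gain this factor as the common denominator grows, and x^(N+1) adds the numerator of its Beta
  integral. The last argument is only a degree bound, so polynomials of different degrees can be
  compared at one bound.\<close>

primrec mellin_poly :: "real \<Rightarrow> real poly \<Rightarrow> nat \<Rightarrow> real poly" where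
  "mellin_poly \<gamma> p 0 = [:coeff p 0:]"
| "mellin_poly \<gamma> p (Suc N) =
     [:\<gamma> + 2 + real N, 1:] * mellin_poly \<gamma> p N + smult (coeff p (Suc N)) (pochhammer [:1, 1:] (Suc N))"

lemma poly_pochhammer: "poly (pochhammer q n) (x::real) = pochhammer (poly q x) n"
  by (induction n) (auto simp: pochhammer_Suc of_nat_poly)

lemma degree_pochhammer_linear: "degree (pochhammer [:1, 1::real:] n) = n"
  and coeff_pochhammer_linear: "coeff (pochhammer [:1, 1::real:] n) n = 1"
proof (induction n)
  case (Suc n)
  have "pochhammer [:1, 1::real:] (Suc n) = [:1 + real n, 1:] * pochhammer [:1, 1:] n"
    by (simp only: pochhammer_rec' of_nat_poly) (simp add: add.commute)
  moreover have "pochhammer [:1, 1::real:] n \<noteq> 0" using Suc by auto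
  ultimately show "degree (pochhammer [:1, 1::real:] (Suc n)) = Suc n"
    "coeff (pochhammer [:1, 1::real:] (Suc n)) (Suc n) = 1"
    using Suc by (simp_all add: degree_mult_eq coeff_eq_0 del: mult_pCons_left) (simp add: coeff_eq_0)
qed auto

lemma degree_mellin_poly: "degree (mellin_poly \<gamma> p N) \<le> N"
proof (induction N)
  case (Suc N)
  have "degree ([:\<gamma> + 2 + real N, 1:] * mellin_poly \<gamma> p N) \<le> 1 + N"
    by (rule order_trans[OF degree_mult_le]) (use Suc in auto)
  moreover have "degree (smult (coeff p (Suc N)) (pochhammer [:1, 1:] (Suc N))) \<le> Suc N"
    by (rule order_trans[OF degree_smult_le]) (simp only: degree_pochhammer_linear)
  ultimately show ?case by (simp only: mellin_poly.simps) (intro degree_add_le, auto)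
qed auto

lemma poly_mellin_poly:
  "poly (mellin_poly \<gamma> p N) s =
     (\<Sum>i\<le>N. coeff p i * pochhammer (s + 1) i * pochhammer (s + \<gamma> + 2 + real i) (N - i))"
proof (induction N)
  case (Suc N)
  have "poly (mellin_poly \<gamma> p (Suc N)) s
     = (s + \<gamma> + 2 + real N) * poly (mellin_poly \<gamma> p N) s + coeff p (Suc N) * pochhammer (s + 1) (Suc N)"
    by (simp only: mellin_poly.simps poly_add poly_mult poly_smult poly_pochhammer) (simp add: algebra_simps)
  also have "(s + \<gamma> + 2 + real N) * poly (mellin_poly \<gamma> p N) s
     = (\<Sum>i\<le>N. coeff p i * pochhammer (s + 1) i * pochhammer (s + \<gamma> + 2 + real i) (Suc N - i))"
    unfolding Suc sum_distrib_left
    by (rule sum.cong) (auto simp: Suc_diff_le pochhammer_Suc of_nat_diff algebra_simps)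
  finally show ?case by simp
qed auto

lemma coeff_mellin_poly: "coeff (mellin_poly \<gamma> p N) N = (\<Sum>i\<le>N. coeff p i)"
proof (induction N)
  case (Suc N)
  have "coeff (mellin_poly \<gamma> p N) (Suc N) = 0"
    using degree_mellin_poly[of \<gamma> p N] by (simp add: coeff_eq_0)
  then show ?case using Suc coeff_pochhammer_linear[of "Suc N"] by simp
qed auto

lemma coeff_mellin_poly_eq: "degree p \<le> N \<Longrightarrow> coeff (mellin_poly \<gamma> p N) N = poly p 1"
  unfolding coeff_mellin_poly by (simp add: poly_altdef) (rule sum.mono_neutral_right, auto simp: coeff_eq_0)

text \<open>For \<open>N > 0\<close> the last linear factor vanishes at this point and kills every
  term except that of x^N. The evaluation reads off the top coefficient, and for \<gamma> > -1 the
  accompanying constant is nonzero.\<close>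

lemma poly_mellin_poly_last:
  "poly (mellin_poly \<gamma> p N) (- \<gamma> - 1 - real N) = coeff p N * ((- 1) ^ N * pochhammer (\<gamma> + 1) N)"
proof -
  have *: "pochhammer (- \<gamma> - real N) N = (- 1) ^ N * pochhammer (\<gamma> + 1) N"
    using pochhammer_minus[of "\<gamma> + real N" N] by (simp add: algebra_simps)
  show ?thesis
  proof (cases N)
    case (Suc M)
    have "poly (mellin_poly \<gamma> p N) (- \<gamma> - 1 - real N) = coeff p N * pochhammer (- \<gamma> - real N) N"
      unfolding Suc by (simp only: mellin_poly.simps poly_add poly_mult poly_smult poly_pochhammer) (simp add: diff_diff_eq add.commute)
    then show ?thesis using * by simp
  qed simp
qed

lemma mellin_poly_add: "mellin_poly \<gamma> (p + q) N = mellin_poly \<gamma> p N + mellin_poly \<gamma> q N"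
proof -
  have "poly (mellin_poly \<gamma> (p + q) N) s = poly (mellin_poly \<gamma> p N + mellin_poly \<gamma> q N) s" for s
    by (simp add: poly_mellin_poly sum.distrib distrib_right)
  then show ?thesis using poly_eq_poly_eq_iff by blast
qed

lemma mellin_poly_smult: "mellin_poly \<gamma> (smult c p) N = smult c (mellin_poly \<gamma> p N)"
  by (induction N) (simp_all add: algebra_simps smult_add_right del: mult_pCons_left)

lemma mellin_poly_sum: "mellin_poly \<gamma> (\<Sum>i\<in>I. f i) N = (\<Sum>i\<in>I. mellin_poly \<gamma> (f i) N)"
proof (induction I rule: infinite_finite_induct)
  case (insert i I) then show ?case by (simp add: mellin_poly_add)
qed (use mellin_poly_smult[of \<gamma> 0 0 N] in auto)

lemma mellin_poly_cong: "(\<And>i. i \<le> N \<Longrightarrow> coeff p i = coeff q i) \<Longrightarrow> mellin_poly \<gamma> p N = mellin_poly \<gamma> q N"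
  by (induction N) auto

text \<open>Since x x^s = x^(s+1), the argument moves to s + 1. The Gamma denominators for the two
  bounds then coincide, and \<Gamma>(s + 2) = (s + 1) \<Gamma>(s + 1) supplies the extra
  factor.\<close>

lemma mellin_poly_mult_X:
  assumes "degree p \<le> N"
  shows "poly (mellin_poly \<gamma> ([:0, 1:] * p) (Suc N)) s = (s + 1) * poly (mellin_poly \<gamma> p N) (s + 1)"
proof -
  have "coeff ([:0, 1:] * p) (Suc i) * pochhammer (s + 1) (Suc i) * pochhammer (s + \<gamma> + 2 + real (Suc i)) (Suc N - Suc i)
    = (s + 1) * (coeff p i * pochhammer (s + 1 + 1) i * pochhammer (s + 1 + \<gamma> + 2 + real i) (N - i))" for i
    by (simp add: pochhammer_rec add_ac)
  then show ?thesis
    unfolding poly_mellin_poly sum.atMost_Suc_shift[of _ N] sum_distrib_left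
    by (simp only:) simp
qed

text \<open>Raising the bound only replaces the denominator \<Gamma>(s + \<gamma> + 2 + l) by
  \<Gamma>(s + \<gamma> + 2 + N). This is the source of the rising factorials in the
  recurrence.\<close>

lemma mellin_poly_add_degree:
  assumes "degree p \<le> l" "l \<le> N"
  shows "poly (mellin_poly \<gamma> p N) s = poly (mellin_poly \<gamma> p l) s * pochhammer (s + \<gamma> + 2 + real l) (N - l)"
proof -
  have "poly (mellin_poly \<gamma> p N) s =
    (\<Sum>i\<le>l. coeff p i * pochhammer (s + 1) i * pochhammer (s + \<gamma> + 2 + real i) (N - i))"
    unfolding poly_mellin_poly using assms by (intro sum.mono_neutral_right) (auto simp: coeff_eq_0)
  also have "\<dots> = (\<Sum>i\<le>l. coeff p i * pochhammer (s + 1) i * pochhammer (s + \<gamma> + 2 + real i) (l - i)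
      * pochhammer (s + \<gamma> + 2 + real l) (N - l))"
  proof (rule sum.cong)
    fix i assume "i \<in> {..l}"
    then have "N - i = (l - i) + (N - l)" "s + \<gamma> + 2 + real i + real (l - i) = s + \<gamma> + 2 + real l"
      using assms by auto
    then show "coeff p i * pochhammer (s + 1) i * pochhammer (s + \<gamma> + 2 + real i) (N - i) =
      coeff p i * pochhammer (s + 1) i * pochhammer (s + \<gamma> + 2 + real i) (l - i)
      * pochhammer (s + \<gamma> + 2 + real l) (N - l)"
      using pochhammer_product'[of "s + \<gamma> + 2 + real i" "l - i" "N - l"] by (simp only: mult.assoc)
  qed simp
  finally show ?thesis unfolding poly_mellin_poly by (simp add: sum_distrib_right)
qed

section \<open>Inversion of the transform and its integral representation\<close>

context
  fixes \<gamma> :: real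
  assumes gamma: "\<gamma> > -1"
begin

lemma pochhammer_gamma_pos: "pochhammer (\<gamma> + 1) N > 0"
  using gamma by (intro pochhammer_pos) auto

text \<open>Evaluation at the point of \<open>poly_mellin_poly_last\<close> shows that the top
  coefficient is 0; the linear factor then cancels and the bound drops by one.\<close>

lemma mellin_poly_eq_0D: "degree p \<le> N \<Longrightarrow> mellin_poly \<gamma> p N = 0 \<Longrightarrow> p = 0"
proof (induction N)
  case 0 then show ?case by (auto elim: degree_eq_zeroE)
next
  case (Suc N)
  have "coeff p (Suc N) = 0"
    using poly_mellin_poly_last[of \<gamma> p "Suc N"] pochhammer_gamma_pos[of "Suc N"]
    unfolding Suc.prems(2) by simp
  moreover from this have "degree p \<le> N"
    using Suc.prems(1) by (intro degree_le) (auto simp: coeff_eq_0 not_less_eq[symmetric] dest: Suc_lessI)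
  moreover have "[:\<gamma> + 2 + real N, 1:] * mellin_poly \<gamma> p N = 0"
    using Suc.prems(2) \<open>coeff p (Suc N) = 0\<close> by (simp del: mult_pCons_left)
  then have "mellin_poly \<gamma> p N = 0" by (simp del: mult_pCons_left)
  ultimately show ?case using Suc.IH by blast
qed

lemma mellin_poly_inject:
  assumes "degree p \<le> N" "degree q \<le> N" "mellin_poly \<gamma> p N = mellin_poly \<gamma> q N"
  shows "p = q"
proof -
  have "mellin_poly \<gamma> (p + smult (-1) q) N = 0"
    unfolding mellin_poly_add mellin_poly_smult using assms by simp
  then have "p + smult (-1) q = 0"
    by (rule mellin_poly_eq_0D[rotated]) (use assms in \<open>auto intro: degree_diff_le\<close>)
  then show ?thesis by simp
qed

text \<open>The same evaluation determines the top coefficient of a preimage. Once its contribution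
  is subtracted, the remainder has a root there, and dividing by the linear factor lowers the
  bound.\<close>

lemma mellin_poly_surj:
  "degree r \<le> N \<Longrightarrow> \<exists>p. degree p \<le> N \<and> mellin_poly \<gamma> p N = r"
proof (induction N arbitrary: r)
  case 0
  then show ?case by (auto elim!: degree_eq_zeroE intro!: exI[of _ r])
next
  case (Suc N)
  let ?x = "- \<gamma> - 1 - real (Suc N)"
  have pn: "pochhammer (?x + 1) (Suc N) = (- 1) ^ Suc N * pochhammer (\<gamma> + 1) (Suc N)"
    using pochhammer_minus[of "\<gamma> + real (Suc N)" "Suc N"] by (simp add: algebra_simps)
  define c where "c = poly r ?x / pochhammer (?x + 1) (Suc N)"
  define u where "u = r - smult c (pochhammer [:1, 1:] (Suc N))"
  have "poly u ?x = 0"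
    unfolding u_def c_def using pochhammer_gamma_pos[of "Suc N"] pn
    by (simp add: poly_pochhammer add.commute del: pochhammer_Suc)
  then have "[:- ?x, 1:] dvd u" by (simp only: poly_eq_0_iff_dvd)
  moreover have "- ?x = \<gamma> + 2 + real N" by simp
  ultimately obtain v where v: "u = [:\<gamma> + 2 + real N, 1:] * v"
    unfolding dvd_def by metis
  have "degree u \<le> Suc N"
    unfolding u_def using Suc.prems
    by (intro degree_diff_le order_trans[OF degree_smult_le]) (simp_all only: degree_pochhammer_linear order_refl)
  then have "degree v \<le> N"
    unfolding v by (cases "v = 0") (auto simp: degree_mult_eq simp del: mult_pCons_left)
  then obtain p where p: "degree p \<le> N" "mellin_poly \<gamma> p N = v"
    using Suc.IH by blast
  \<comment> \<open>At bound \<open>N\<close> the added monomial is invisible, so it alters only the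
    last recursion step.\<close>
  have "mellin_poly \<gamma> (p + monom c (Suc N)) N = v"
    unfolding p(2)[symmetric] by (rule mellin_poly_cong) auto
  moreover have "coeff (p + monom c (Suc N)) (Suc N) = c"
    using p(1) by (simp add: coeff_eq_0)
  ultimately have "mellin_poly \<gamma> (p + monom c (Suc N)) (Suc N) = r"
    using v by (simp add: u_def del: mult_pCons_left)
  moreover have "degree (p + monom c (Suc N)) \<le> Suc N"
    using p(1) by (intro degree_add_le degree_monom_le) auto
  ultimately show ?case by blast
qed

text \<open>Termwise this is Euler's Beta integral; the shift rule for Gamma brings all terms over
  one denominator.\<close>

lemma has_integral_mellin_poly:
  assumes s: "s > -1" and N: "degree p \<le> N"
  shows "((\<lambda>x. poly p x * x powr s * (1 - x) powr \<gamma>) has_integral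
    Gamma (\<gamma> + 1) * Gamma (s + 1) / Gamma (s + \<gamma> + 2 + real N) * poly (mellin_poly \<gamma> p N) s) {0..1}"
proof -
  have pG: "pochhammer z n * Gamma z = Gamma (z + real n)" if "z > 0" for z :: real and n
  proof -
    from that have "z \<notin> \<int>\<^sub>\<le>\<^sub>0" by (auto elim!: nonpos_Ints_cases)
    then show ?thesis by (simp add: pochhammer_Gamma Gamma_eq_zero_iff)
  qed
  have "((\<lambda>x. \<Sum>i\<le>N. coeff p i * (x powr ((s + real i + 1) - 1) * (1 - x) powr ((\<gamma> + 1) - 1)))
      has_integral (\<Sum>i\<le>N. coeff p i * Beta (s + real i + 1) (\<gamma> + 1))) {0..1}"
    using s gamma by (intro has_integral_sum has_integral_mult_right has_integral_Beta_real) auto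
  also have "(\<Sum>i\<le>N. coeff p i * Beta (s + real i + 1) (\<gamma> + 1)) =
    Gamma (\<gamma> + 1) * Gamma (s + 1) / Gamma (s + \<gamma> + 2 + real N) * poly (mellin_poly \<gamma> p N) s"
    unfolding poly_mellin_poly sum_distrib_left
  proof (rule sum.cong)
    fix i assume "i \<in> {..N}"
    then have i: "s + \<gamma> + 2 + real i + real (N - i) = s + \<gamma> + 2 + real N" by simp
    have pos: "s + \<gamma> + 2 + real i > 0" "s + \<gamma> + 2 + real N > 0" using s gamma by auto
    have nz: "Gamma (s + \<gamma> + 2 + real i) > 0" "Gamma (s + \<gamma> + 2 + real N) > 0"
      using pos by (simp_all add: Gamma_real_pos)
    have 1: "Gamma (s + real i + 1) = pochhammer (s + 1) i * Gamma (s + 1)"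
      using pG[of "s + 1" i] s by (simp add: algebra_simps)
    have 2: "Gamma (s + \<gamma> + 2 + real N) = pochhammer (s + \<gamma> + 2 + real i) (N - i) * Gamma (s + \<gamma> + 2 + real i)"
      using pG[OF pos(1), of "N - i"] unfolding i ..
    have 3: "s + real i + 1 + (\<gamma> + 1) = s + \<gamma> + 2 + real i" by simp
    show "coeff p i * Beta (s + real i + 1) (\<gamma> + 1) = Gamma (\<gamma> + 1) * Gamma (s + 1) / Gamma (s + \<gamma> + 2 + real N) *
      (coeff p i * pochhammer (s + 1) i * pochhammer (s + \<gamma> + 2 + real i) (N - i))"
      unfolding Beta_def 1 3 2 using nz(1) nz(2)[unfolded 2] by (cases "pochhammer (s + \<gamma> + 2 + real i) (N - i) = 0") auto
  qed simp
  finally have int: "((\<lambda>x. \<Sum>i\<le>N. coeff p i * (x powr ((s + real i + 1) - 1) * (1 - x) powr ((\<gamma> + 1) - 1)))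
      has_integral Gamma (\<gamma> + 1) * Gamma (s + 1) / Gamma (s + \<gamma> + 2 + real N) * poly (mellin_poly \<gamma> p N) s) {0..1}" .
  show ?thesis
  proof (rule has_integral_eq[OF _ int])
    fix x :: real assume x: "x \<in> {0..1}"
    have "poly p x = (\<Sum>i\<le>N. coeff p i * x ^ i)"
      unfolding poly_altdef using N by (intro sum.mono_neutral_left) (auto simp: coeff_eq_0)
    \<comment> \<open>At x = 0 both sides are 0, because \<open>powr\<close> with base 0 is 0 for
      every exponent.\<close>
    moreover have "x powr (s + real i) = x ^ i * x powr s" for i
      using x by (cases "x = 0") (auto simp: powr_add powr_realpow)
    ultimately show "(\<Sum>i\<le>N. coeff p i * (x powr ((s + real i + 1) - 1) * (1 - x) powr ((\<gamma> + 1) - 1)))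
      = poly p x * x powr s * (1 - x) powr \<gamma>"
      by (simp add: sum_distrib_right mult.assoc)
  qed
qed

text \<open>All Gamma factors are positive here, so an orthogonality condition becomes a zero of the
  transformed polynomial.\<close>

lemma has_integral_0_iff:
  assumes "s > -1" and "degree p \<le> N"
  shows "((\<lambda>x. poly p x * x powr s * (1 - x) powr \<gamma>) has_integral 0) {0..1} \<longleftrightarrow>
     poly (mellin_poly \<gamma> p N) s = 0"
proof -
  have "Gamma (\<gamma> + 1) > 0" "Gamma (s + 1) > 0" "Gamma (s + \<gamma> + 2 + real N) > 0"
    using assms gamma by (auto intro!: Gamma_real_pos)
  then show ?thesis
    using has_integral_mellin_poly[OF assms] by (auto dest: has_integral_unique)
qed

end

section \<open>Step-line polynomials and the recurrence\<close>

text \<open>The largest index with nonzero weight alone contributes in its own degree, so nothing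
  can cancel it.\<close>

lemma sum_smult_graded_eq_0:
  fixes b :: "nat \<Rightarrow> 'a::idom poly"
  assumes fin: "finite S" and b: "\<And>l. degree (b l) = l" "\<And>l. coeff (b l) l \<noteq> 0"
    and sum: "(\<Sum>l\<in>S. smult (d l) (b l)) = 0" and l: "l \<in> S"
  shows "d l = 0"
proof (rule ccontr)
  assume "d l \<noteq> 0"
  define T where "T = {l \<in> S. d l \<noteq> 0}"
  have T: "finite T" "T \<noteq> {}" using fin l \<open>d l \<noteq> 0\<close> by (auto simp: T_def)
  define M where "M = Max T"
  have M: "M \<in> T" "\<And>l. l \<in> T \<Longrightarrow> l \<le> M" using T by (auto simp: M_def)
  have "0 = (\<Sum>l\<in>S. d l * coeff (b l) M)"
    using arg_cong[OF sum, of "\<lambda>p. coeff p M"] by (simp add: coeff_sum)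
  also have "\<dots> = (\<Sum>l\<in>{M}. d l * coeff (b l) M)"
  proof (rule sum.mono_neutral_right)
    show "\<forall>l\<in>S - {M}. d l * coeff (b l) M = 0"
    proof
      fix l assume l: "l \<in> S - {M}"
      show "d l * coeff (b l) M = 0"
      proof (cases "d l = 0")
        case False
        then have "l < M" using l M(2)[of l] by (auto simp: T_def)
        then show ?thesis by (simp add: coeff_eq_0 b(1))
      qed simp
    qed
  qed (use fin M(1) in \<open>auto simp: T_def\<close>)
  also have "\<dots> \<noteq> 0" using M(1) b(2) by (auto simp: T_def)
  finally show False by simp
qed

section \<open>Type II polynomials characterised by the zeros of their transforms\<close>

locale jacobi_pineiro =
  fixes \<alpha> \<beta> \<gamma> :: real
  assumes alpha: "\<alpha> > -1" and beta: "\<beta> > -1" and gamma: "\<gamma> > -1"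
    and neq: "\<alpha> \<noteq> \<beta>" and close: "\<bar>\<alpha> - \<beta>\<bar> < 1"
begin

text \<open>Its zeros are the exponents of the orthogonality conditions, so it is the expected
  transform up to a scalar.\<close>

definition node_poly :: "nat \<Rightarrow> nat \<Rightarrow> real poly" where
  "node_poly n m = (\<Prod>j<n. [:- (\<alpha> + real j), 1:]) * (\<Prod>j<m. [:- (\<beta> + real j), 1:])"

lemma node_poly_monic: "degree (node_poly n m) = n + m" "coeff (node_poly n m) (n + m) = 1"
proof -
  have deg: "degree (\<Prod>j<k. [:- (a + real j), 1:]) = k" for a k
    by (subst degree_prod_eq_sum_degree) auto
  have lead: "lead_coeff (\<Prod>j<k. [:- (a + real j), 1:]) = 1" for a k
    by (simp only: lead_coeff_prod) simp
  show "degree (node_poly n m) = n + m"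
    unfolding node_poly_def by (subst degree_mult_eq, simp_all only: deg) auto
  moreover have "lead_coeff (node_poly n m) = 1"
    unfolding node_poly_def lead_coeff_mult lead by simp
  ultimately show "coeff (node_poly n m) (n + m) = 1" by simp
qed

lemma poly_node_poly: "poly (node_poly n m) s = (\<Prod>j<n. s - \<alpha> - real j) * (\<Prod>j<m. s - \<beta> - real j)"
  by (simp add: node_poly_def poly_prod algebra_simps)

lemma card_nodes: "card ((\<lambda>j. \<alpha> + real j) ` {..<n} \<union> (\<lambda>j. \<beta> + real j) ` {..<m}) = n + m"
proof -
  have "\<alpha> + real i \<noteq> \<beta> + real j" for i j
  proof
    assume "\<alpha> + real i = \<beta> + real j"
    \<comment> \<open>A collision of nodes would make \<alpha> - \<beta> an integer of absolute
      value below 1, hence 0.\<close>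
    then have "\<alpha> - \<beta> = real_of_int (int j - int i)" by simp
    moreover from this have "\<bar>int j - int i\<bar> < 1" using close by linarith
    ultimately show False using neq by simp
  qed
  then have "(\<lambda>j. \<alpha> + real j) ` {..<n} \<inter> (\<lambda>j. \<beta> + real j) ` {..<m} = {}" by auto
  then show ?thesis
    by (subst card_Un_disjoint) (auto simp: card_image inj_on_def)
qed

text \<open>Orthogonality gives n + m distinct zeros of a polynomial of degree at most n + m with
  top coefficient p(1), which fixes it completely. On the right, the coefficient 1 turns the degree
  bound into an equality.\<close>

lemma is_jacobi_pineiro_II_iff:
  "is_jacobi_pineiro_II \<alpha> \<beta> \<gamma> n m p \<longleftrightarrow>
     degree p \<le> n + m \<and> coeff p (n + m) = 1 \<and>
     mellin_poly \<gamma> p (n + m) = smult (poly p 1) (node_poly n m)"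
proof (cases "degree p = n + m \<and> coeff p (n + m) = 1")
  case True
  let ?A = "(\<lambda>j. \<alpha> + real j) ` {..<n} \<union> (\<lambda>j. \<beta> + real j) ` {..<m}"
  have "is_jacobi_pineiro_II \<alpha> \<beta> \<gamma> n m p \<longleftrightarrow> (\<forall>x\<in>?A. poly (mellin_poly \<gamma> p (n + m)) x = 0)"
  proof -
    have "\<alpha> + real j > -1" "\<beta> + real j > -1" for j using alpha beta by auto
    then show ?thesis
      using True unfolding is_jacobi_pineiro_II_def
      by (auto simp: has_integral_0_iff[OF gamma, of _ p "n + m"])
  qed
  also have "\<dots> \<longleftrightarrow> mellin_poly \<gamma> p (n + m) = smult (poly p 1) (node_poly n m)"
  proof
    assume zero: "\<forall>x\<in>?A. poly (mellin_poly \<gamma> p (n + m)) x = 0"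
    show "mellin_poly \<gamma> p (n + m) = smult (poly p 1) (node_poly n m)"
    proof (rule poly_eqI_degree_lead_coeff[where A = ?A])
      show "coeff (mellin_poly \<gamma> p (n + m)) (n + m) = coeff (smult (poly p 1) (node_poly n m)) (n + m)"
        using True by (simp add: coeff_mellin_poly_eq node_poly_monic)
      show "degree (smult (poly p 1) (node_poly n m)) \<le> n + m"
        using degree_smult_le[of "poly p 1" "node_poly n m"] by (simp add: node_poly_monic)
      show "poly (mellin_poly \<gamma> p (n + m)) z = poly (smult (poly p 1) (node_poly n m)) z" if "z \<in> ?A" for z
        using that zero by (auto simp: poly_node_poly prod_zero_iff)
    qed (auto simp: card_nodes degree_mellin_poly)
  qed (auto simp: poly_node_poly prod_zero_iff)
  finally show ?thesis using True by simp
next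
  case False
  have "\<not> is_jacobi_pineiro_II \<alpha> \<beta> \<gamma> n m p"
    using False by (auto simp: is_jacobi_pineiro_II_def)
  moreover have "\<not> (degree p \<le> n + m \<and> coeff p (n + m) = 1)"
    using False le_degree[of p "n + m"] by auto
  ultimately show ?thesis by blast
qed

text \<open>For n + m > 0 the point lies below -1 and every node above -1; otherwise the product is
  empty.\<close>

lemma node_poly_last_nz: "poly (node_poly n m) (- \<gamma> - 1 - real (n + m)) \<noteq> 0"
  using alpha beta gamma by (auto simp: poly_node_poly prod_zero_iff)

text \<open>Monicity fixes the free scalar: at -\<gamma> - 1 - (n + m) the transform equals a
  nonzero constant and also p(1) times a nonzero node value. Surjectivity of the transform gives
  existence and injectivity uniqueness, so the definite description is well defined.\<close>

lemma jacobi_pineiro_II: "is_jacobi_pineiro_II \<alpha> \<beta> \<gamma> n m (jacobi_pineiro_II \<alpha> \<beta> \<gamma> n m)"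
  and jacobi_pineiro_II_1_nz: "poly (jacobi_pineiro_II \<alpha> \<beta> \<gamma> n m) 1 \<noteq> 0"
proof -
  let ?N = "n + m" and ?R = "node_poly n m"
  let ?x = "- \<gamma> - 1 - real ?N"
  define h where "h = (- 1) ^ ?N * pochhammer (\<gamma> + 1) ?N"
  have h: "h \<noteq> 0" using pochhammer_gamma_pos[OF gamma, of ?N] by (simp add: h_def)
  have at_1: "poly p 1 = h / poly ?R ?x" if "is_jacobi_pineiro_II \<alpha> \<beta> \<gamma> n m p" for p
    using that poly_mellin_poly_last[of \<gamma> p ?N] node_poly_last_nz[of n m]
    unfolding is_jacobi_pineiro_II_iff h_def by (simp add: field_simps)
  have "\<exists>!p. is_jacobi_pineiro_II \<alpha> \<beta> \<gamma> n m p"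
  proof (rule ex_ex1I)
    obtain p where p: "degree p \<le> ?N" "mellin_poly \<gamma> p ?N = smult (h / poly ?R ?x) ?R"
      using mellin_poly_surj[OF gamma, of "smult (h / poly ?R ?x) ?R" ?N]
        degree_smult_le[of "h / poly ?R ?x" ?R] by (auto simp: node_poly_monic)
    have "h / poly ?R ?x = poly p 1"
      using coeff_mellin_poly_eq[OF p(1), of \<gamma>] p(2) by (simp add: node_poly_monic)
    moreover have "coeff p ?N = 1"
      using poly_mellin_poly_last[of \<gamma> p ?N] node_poly_last_nz[of n m] h
      unfolding p(2) h_def[symmetric] by simp
    ultimately show "\<exists>p. is_jacobi_pineiro_II \<alpha> \<beta> \<gamma> n m p"
      using p unfolding is_jacobi_pineiro_II_iff by auto
  next
    fix p q assume "is_jacobi_pineiro_II \<alpha> \<beta> \<gamma> n m p" "is_jacobi_pineiro_II \<alpha> \<beta> \<gamma> n m q"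
    with at_1[of p] at_1[of q] show "p = q"
      unfolding is_jacobi_pineiro_II_iff by (intro mellin_poly_inject[OF gamma, of p ?N q]) auto
  qed
  then show *: "is_jacobi_pineiro_II \<alpha> \<beta> \<gamma> n m (jacobi_pineiro_II \<alpha> \<beta> \<gamma> n m)"
    unfolding jacobi_pineiro_II_def by (rule theI')
  show "poly (jacobi_pineiro_II \<alpha> \<beta> \<gamma> n m) 1 \<noteq> 0"
    using at_1[OF *] h node_poly_last_nz[of n m] by simp
qed

section \<open>Step-line sequence and its recurrence coefficients\<close>

abbreviation B :: "nat \<Rightarrow> real poly" where "B \<equiv> step_line_poly \<alpha> \<beta> \<gamma>"

text \<open>Rounding k / 2 up and down gives the step-line indices for both parities at
  once.\<close>

definition step_node_poly :: "nat \<Rightarrow> real poly" where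
  "step_node_poly k = node_poly ((k + 1) div 2) (k div 2)"

lemma step_line_poly_eq: "B k = jacobi_pineiro_II \<alpha> \<beta> \<gamma> ((k + 1) div 2) (k div 2)"
  by (auto simp: step_line_poly_def elim: evenE oddE)

lemma half_sum: "(k + 1) div 2 + k div 2 = (k::nat)"
  by presburger

lemma step_line_poly:
  shows degree_step_line_poly: "degree (B k) = k"
    and coeff_step_line_poly: "coeff (B k) k = 1"
    and mellin_step_line_poly: "mellin_poly \<gamma> (B k) k = smult (poly (B k) 1) (step_node_poly k)"
    and step_line_poly_1_nz: "poly (B k) 1 \<noteq> 0"
proof -
  have *: "degree (B k) \<le> k" "coeff (B k) k = 1" "mellin_poly \<gamma> (B k) k = smult (poly (B k) 1) (step_node_poly k)"
    using jacobi_pineiro_II[of "(k + 1) div 2" "k div 2"]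
    unfolding is_jacobi_pineiro_II_iff step_line_poly_eq[symmetric] half_sum step_node_poly_def by auto
  then show "degree (B k) = k" "coeff (B k) k = 1"
      "mellin_poly \<gamma> (B k) k = smult (poly (B k) 1) (step_node_poly k)"
    using le_degree[of "B k" k] by auto
  show "poly (B k) 1 \<noteq> 0"
    unfolding step_line_poly_eq by (rule jacobi_pineiro_II_1_nz)
qed

text \<open>\<open>jacobi_matrix\<close> is a definite description, so uniqueness is needed as well:
  two finite expansions in polynomials of distinct degrees agree by linear independence.\<close>

lemma jacobi_matrix_eqI:
  assumes up: "\<And>k l. l > k + 1 \<Longrightarrow> J k l = 0"
    and mult: "\<And>k. [:0, 1:] * B k = (\<Sum>l\<le>k + 1. smult (J k l) (B l))"
  shows "jacobi_matrix \<alpha> \<beta> \<gamma> = J"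
  unfolding jacobi_matrix_def
proof (rule the_equality)
  have fin: "finite {l. J k l \<noteq> 0}" for k
    by (rule finite_subset[of _ "{..k + 1}"]) (use up[of k] in \<open>auto simp: not_le[symmetric]\<close>)
  have mult': "[:0, 1:] * B k = (\<Sum>l\<in>{l. J k l \<noteq> 0}. smult (J k l) (B l))" for k
    unfolding mult by (rule sum.mono_neutral_right) (use up[of k] in \<open>auto simp: not_le[symmetric]\<close>)
  show "\<forall>k. finite {l. J k l \<noteq> 0} \<and> [:0, 1:] * B k = (\<Sum>l\<in>{l. J k l \<noteq> 0}. smult (J k l) (B l))"
    using fin mult' by blast
  fix J' assume J': "\<forall>k. finite {l. J' k l \<noteq> 0} \<and>
    [:0, 1:] * B k = (\<Sum>l\<in>{l. J' k l \<noteq> 0}. smult (J' k l) (B l))"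
  show "J' = J"
  proof (intro ext)
    fix k l
    \<comment> \<open>The two supports are merged; \<open>l\<close> is inserted because its entry
      may vanish in both matrices.\<close>
    let ?S = "insert l ({l. J' k l \<noteq> 0} \<union> {l. J k l \<noteq> 0})"
    have finS: "finite ?S" using fin J' by auto
    have "[:0, 1:] * B k = (\<Sum>l\<in>?S. smult (J' k l) (B l))"
      using J' finS by (subst J'[rule_format, THEN conjunct2]) (intro sum.mono_neutral_left, auto)
    moreover have "[:0, 1:] * B k = (\<Sum>l\<in>?S. smult (J k l) (B l))"
      using finS by (subst mult') (intro sum.mono_neutral_left, auto)
    ultimately have "(\<Sum>l\<in>?S. smult (J' k l - J k l) (B l)) = 0"
      unfolding smult_diff_left sum_subtractf by simp
    then have "J' k l - J k l = 0"
      by (rule sum_smult_graded_eq_0[OF finS, rotated 2])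
        (simp_all add: degree_step_line_poly coeff_step_line_poly)
    then show "J' k l = J k l" by simp
  qed
qed

text \<open>\<open>row\<close> is the transform, at bound k + 1, of the recurrence divided by the
  value of \<open>B k\<close> at 1. Injectivity of the transform carries it back to
  polynomials.\<close>

lemma stochastic_matrix_II_eqI:
  assumes up: "\<And>k l. l > k + 1 \<Longrightarrow> P k l = 0"
    and row: "\<And>k s. (s + 1) * poly (step_node_poly k) (s + 1) =
      (\<Sum>l\<le>k + 1. P k l * (poly (step_node_poly l) s * pochhammer (s + \<gamma> + 2 + real l) (k + 1 - l)))"
  shows "stochastic_matrix_II \<alpha> \<beta> \<gamma> = P"
proof -
  let ?c = "\<lambda>k. poly (B k) 1"
  have "[:0, 1:] * B k = (\<Sum>l\<le>k + 1. smult (P k l * ?c k / ?c l) (B l))" for k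
  proof (rule mellin_poly_inject[OF gamma, of _ "k + 1"])
    show "degree ([:0, 1:] * B k) \<le> k + 1"
      by (rule order_trans[OF degree_mult_le]) (simp add: degree_step_line_poly)
    show "degree (\<Sum>l\<le>k + 1. smult (P k l * ?c k / ?c l) (B l)) \<le> k + 1"
      by (intro degree_sum_le order_trans[OF degree_smult_le]) (auto simp: degree_step_line_poly)
    have "poly (mellin_poly \<gamma> ([:0, 1:] * B k) (k + 1)) s
      = poly (mellin_poly \<gamma> (\<Sum>l\<le>k + 1. smult (P k l * ?c k / ?c l) (B l)) (k + 1)) s" for s
    proof -
      have "poly (mellin_poly \<gamma> ([:0, 1:] * B k) (k + 1)) s
        = ?c k * ((s + 1) * poly (step_node_poly k) (s + 1))"
        using mellin_poly_mult_X[of "B k" k \<gamma> s]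
        by (simp only: degree_step_line_poly mellin_step_line_poly Suc_eq_plus1 order_refl) simp
      also have "\<dots> = (\<Sum>l\<le>k + 1. ?c k *
          (P k l * (poly (step_node_poly l) s * pochhammer (s + \<gamma> + 2 + real l) (k + 1 - l))))"
        unfolding row sum_distrib_left ..
      also have "\<dots> = (\<Sum>l\<le>k + 1. P k l * ?c k / ?c l * poly (mellin_poly \<gamma> (B l) (k + 1)) s)"
      proof (rule sum.cong)
        fix l assume "l \<in> {..k + 1}"
        then have "poly (mellin_poly \<gamma> (B l) (k + 1)) s
          = ?c l * poly (step_node_poly l) s * pochhammer (s + \<gamma> + 2 + real l) (k + 1 - l)"
          using mellin_poly_add_degree[of "B l" l "k + 1" \<gamma> s]
          by (simp add: degree_step_line_poly mellin_step_line_poly)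
        then show "?c k * (P k l * (poly (step_node_poly l) s * pochhammer (s + \<gamma> + 2 + real l) (k + 1 - l)))
          = P k l * ?c k / ?c l * poly (mellin_poly \<gamma> (B l) (k + 1)) s"
          using step_line_poly_1_nz[of l] by simp
      qed simp
      finally show ?thesis by (simp only: mellin_poly_sum mellin_poly_smult poly_sum poly_smult)
    qed
    then show "mellin_poly \<gamma> ([:0, 1:] * B k) (k + 1)
      = mellin_poly \<gamma> (\<Sum>l\<le>k + 1. smult (P k l * ?c k / ?c l) (B l)) (k + 1)"
      using poly_eq_poly_eq_iff by blast
  qed
  then have "jacobi_matrix \<alpha> \<beta> \<gamma> = (\<lambda>k l. P k l * ?c k / ?c l)"
    by (intro jacobi_matrix_eqI) (simp_all add: up)
  then show ?thesis
    using step_line_poly_1_nz by (intro ext) (simp add: stochastic_matrix_II_def)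
qed

end

section \<open>Rational identities\<close>

text \<open>In each of four groups with a common denominator the combined numerator is divisible by
  one denominator factor: \<open>a+2\<close>, \<open>b\<close>, \<open>b\<close> and
  \<open>a-1\<close> in turn. After cancellation everything fits over \<open>(a+1)*a*(b+1)\<close>,
  and only polynomial identities remain to be checked.\<close>

lemma even_fractions:
  fixes a b :: real
  assumes "p*T0 + p'*T1 = P*(a+2)" "q*T1 + w*T2 = Q*b" "r*T1 + v * T2 = R*b" "u*T2 + z*T3 = U*(a-1)"
    and "L*((a+1)*a*(b+1)) = (P+Q)*a + (R+U)*(b+1)"
    and nz: "a-1 \<noteq> 0" "a \<noteq> 0" "a+1 \<noteq> 0" "a+2 \<noteq> 0" "b \<noteq> 0" "b+1 \<noteq> 0"
  shows "L = p/((a+1)*(a+2)*(b+1))*T0 + (p'/((a+1)*(a+2)*(b+1)) + q/((a+1)*b*(b+1)) + r/(a*(a+1)*b))*T1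
    + (u/((a-1)*a*(a+1)) + v/(a*(a+1)*b) + w/((a+1)*b*(b+1)))*T2 + z/((a-1)*a*(a+1))*T3" (is "_ = ?R")
proof -
  have "?R = (p*T0 + p'*T1)/((a+1)*(a+2)*(b+1)) + (q*T1 + w*T2)/((a+1)*b*(b+1))
      + (r*T1 + v * T2)/(a*(a+1)*b) + (u*T2 + z*T3)/((a-1)*a*(a+1))"
    by (simp add: distrib_right add_divide_distrib)
  also have "\<dots> = P/((a+1)*(b+1)) + Q/((a+1)*(b+1)) + R/(a*(a+1)) + U/(a*(a+1))"
    unfolding assms(1-4) using nz by simp
  also have "\<dots> = ((P+Q)*a + (R+U)*(b+1)) / ((a+1)*a*(b+1))"
    using nz by (simp add: divide_simps) (simp add: algebra_simps)
  also have "\<dots> = L"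
    unfolding assms(5)[symmetric] using nz by simp
  finally show ?thesis by simp
qed

text \<open>
  Dividing a row of the recurrence by the common factors leaves the identities below, with
  \<open>A = \<alpha> + \<gamma> + 3n\<close>, \<open>B = \<beta> + \<gamma> + 3n\<close>, \<open>g = \<gamma> + 2n\<close> and \<open>t = s + \<gamma> + 2n\<close>.
  In the even case the four groups of fractions each contain the factor \<open>t + 1 - g\<close>. The odd case
  reduces to the partial fraction expansion with poles at \<open>t = B - 1, A, B, -3\<close>.
\<close>

lemma even_row_identity:
  fixes A B g n t :: real
  assumes nz: "A-1 \<noteq> 0" "A \<noteq> 0" "A+1 \<noteq> 0" "A+2 \<noteq> 0" "B \<noteq> 0" "B+1 \<noteq> 0"
  shows "(t+1-g)*(t+1-A+n)*(t+1-B+n) =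
   (g+1)*(A-n+1)*(B-n+1)/((A+1)*(A+2)*(B+1)) * ((t-A+1)*(t-B+1)*(t-A))
   + ((A-g+1)*(A-n+1)*(B-n+1)/((A+1)*(A+2)*(B+1))+n*g*(A-n+1)/((A+1)*B*(B+1))+n*g*(B-n)/(A*(A+1)*B)) * ((t-A+1)*(t-B+1)*(t+2))
   + (n*(A-B+n)*(g-1)/((A-1)*A*(A+1))+n*(B-g)*(B-n)/(A*(A+1)*B)+n*(B-g)*(A-n+1)/((A+1)*B*(B+1))) * ((t-A+1)*(t+1)*(t+2))
   + n*(A-B+n)*(A-g)/((A-1)*A*(A+1)) * (t*(t+1)*(t+2))"
proof (rule even_fractions)
  let ?P = "(A-n+1)*(B-n+1)*(t-A+1)*(t-B+1)*(t+1-g)"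
  let ?Q = "n*(A-n+1)*(t-A+1)*(t+2)*(t+1-g)"
  let ?R = "n*(B-n)*(t-A+1)*(t+2)*(t+1-g)"
  let ?U = "n*(A-B+n)*(t+1)*(t+2)*(t+1-g)"
  show "(g+1)*(A-n+1)*(B-n+1)*((t-A+1)*(t-B+1)*(t-A))
    + (A-g+1)*(A-n+1)*(B-n+1)*((t-A+1)*(t-B+1)*(t+2)) = ?P*(A+2)" by algebra
  show "n*g*(A-n+1)*((t-A+1)*(t-B+1)*(t+2)) + n*(B-g)*(A-n+1)*((t-A+1)*(t+1)*(t+2)) = ?Q*B" by algebra
  show "n*g*(B-n)*((t-A+1)*(t-B+1)*(t+2)) + n*(B-g)*(B-n)*((t-A+1)*(t+1)*(t+2)) = ?R*B" by algebra
  show "n*(A-B+n)*(g-1)*((t-A+1)*(t+1)*(t+2)) + n*(A-B+n)*(A-g)*(t*(t+1)*(t+2)) = ?U*(A-1)" by algebra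
  show "(t+1-g)*(t+1-A+n)*(t+1-B+n)*((A+1)*A*(B+1)) = (?P+?Q)*A + (?R+?U)*(B+1)" by algebra
qed fact+

text \<open>Shaped for Lagrange interpolation at -3, B - 1, A and B: \<open>a\<close>,
  \<open>b\<close>, \<open>c\<close>, \<open>d\<close>, \<open>e\<close> stand for the node
  differences A + 3, B + 2, B + 3, A - B + 1 and B - A. The remaining difference, B - (B - 1), is
  1.\<close>

lemma add_fractions:
  fixes a b c d e :: real
  assumes "X*(e*d)+Y*(a*c*e)-Z*(b*c)+W*(d*a*b) = L*(a*b*c*e*d)"
    and "a \<noteq> 0" "b \<noteq> 0" "c \<noteq> 0" "d \<noteq> 0" "e \<noteq> 0"
  shows "X/(a*b*c) + Y/(d*b) - Z/(d*a*e) + W/(e*c) = L"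
proof -
  have "X/(a*b*c) + Y/(d*b) - Z/(d*a*e) + W/(e*c)
    = (X*(e*d)+Y*(a*c*e)-Z*(b*c)+W*(d*a*b)) / (a*b*c*e*d)"
    using assms(2-) by (simp add: field_simps)
  then show ?thesis using assms by simp
qed

text \<open>Merges the four terms with the factor n(B - g) into the interpolation term at the node B
  - 1. Here \<open>a\<close>, \<open>b\<close>, \<open>c\<close>, \<open>d\<close>, \<open>e\<close>
  are B - A, B, A - B + 1, B + 1 and B + 2, so B - A, B and B + 1 cancel.\<close>

lemma beta_fractions:
  fixes a b c d e :: real
  assumes "- x*T1*c*d*e + y*T1*e + z*T2*a + w*T3*a*c = s*a*b*d"
    and nz: "a \<noteq> 0" "b \<noteq> 0" "c \<noteq> 0" "d \<noteq> 0" "e \<noteq> 0"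
  shows "- (x/(a*b))*T1 + y/(a*c*b*d)*T1 + z/(c*b*d*e)*T2 + w/(b*d*e)*T3 = s/(c*e)"
proof -
  have "- (x/(a*b))*T1 + y/(a*c*b*d)*T1 + z/(c*b*d*e)*T2 + w/(b*d*e)*T3
    = (- x*T1*c*d*e + y*T1*e + z*T2*a + w*T3*a*c) / (a*b*c*d*e)"
    using nz by (simp add: divide_simps) (simp add: algebra_simps)
  then show ?thesis using assms by simp
qed

text \<open>Likewise, the two terms with the factor A - g + 1 give the interpolation term at the
  node A; only \<open>d\<close>, which is A + 2, cancels.\<close>

lemma alpha_fractions:
  fixes a c d e :: real
  assumes "- x*T1 + y*T2*a = - s*d"
    and nz: "a \<noteq> 0" "c \<noteq> 0" "d \<noteq> 0" "e \<noteq> 0"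
  shows "- (x/(a*c*d*e))*T1 + y/(c*d*e)*T2 = - (s/(c*e*a))"
proof -
  have "- (x/(a*c*d*e))*T1 + y/(c*d*e)*T2 = (- x*T1 + y*T2*a) / (a*c*d*e)"
    using nz by (simp add: divide_simps)
  then show ?thesis using assms by simp
qed

lemma odd_row_identity:
  fixes A B g n t :: real
  assumes nz: "A+2 \<noteq> 0" "A+3 \<noteq> 0" "B+2 \<noteq> 0" "B+3 \<noteq> 0" "B-A \<noteq> 0" "A-B+1 \<noteq> 0"
    and nB: "n = 0 \<or> B \<noteq> 0 \<and> B+1 \<noteq> 0"
  shows "(t+1-g)*(t+1-A+n)*(t+1-B+n) =
     (g+2)*(A-n+2)*(B-n+2)/((A+3)*(B+2)*(B+3)) * ((t-B+1)*(t-A)*(t-B))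
   + (- (n*(B-g)*(B-A+n)/((B-A)*B)) + n*(B-g)*(B-A+n)*(A+1)/((B-A)*(A-B+1)*B*(B+1))
      - (n+1)*(A-g+1)*(A-B+n+1)*(B+2)/((B-A)*(A-B+1)*(A+2)*(A+3))
      + (n+1)*(B-g+1)*(B-A+n+1)/((B-A)*(B+3))) * ((t-A)*(t-B+1)*(t+3))
   + (n*(A-B-n)*(B-g)*(A+1)/((A-B+1)*B*(B+1)*(B+2))
      + (n+1)*(A-B+n+1)*(A-g+1)/((A-B+1)*(A+2)*(A+3))) * ((t-B+1)*(t+2)*(t+3))
   + n*(B-A+n)*(B-g)/(B*(B+1)*(B+2)) * ((t+1)*(t+2)*(t+3))" (is "_ = ?R")
proof -
  have regroup: "q + (- x1+x2-x3+x4)*T1+(y1+y2)*T2+z*T3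
    = q + (- x1*T1+x2*T1+y1*T2+z*T3) + (- x3*T1+y2*T2) + x4*T1"
    for q x1 x2 x3 x4 y1 y2 z T1 T2 T3 :: real
    by algebra
  have beta: "- (n*(B-g)*(B-A+n)/((B-A)*B)) * ((t-A)*(t-B+1)*(t+3))
      + n*(B-g)*(B-A+n)*(A+1)/((B-A)*(A-B+1)*B*(B+1)) * ((t-A)*(t-B+1)*(t+3))
      + n*(A-B-n)*(B-g)*(A+1)/((A-B+1)*B*(B+1)*(B+2)) * ((t-B+1)*(t+2)*(t+3))
      + n*(B-A+n)*(B-g)/(B*(B+1)*(B+2)) * ((t+1)*(t+2)*(t+3))
      = n*(B-g)*(B-A+n)*((t+3)*(t-A)*(t-B))/((A-B+1)*(B+2))"
  \<comment> \<open>For n = 0 all numerators vanish, which covers a zero B or B + 1.\<close>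
  proof (cases "n = 0")
    case False
    with nB have B: "B \<noteq> 0" "B+1 \<noteq> 0" by auto
    show ?thesis
      by (rule beta_fractions, algebra) (use nz B in auto)
  qed simp
  have alpha: "- ((n+1)*(A-g+1)*(A-B+n+1)*(B+2)/((B-A)*(A-B+1)*(A+2)*(A+3))) * ((t-A)*(t-B+1)*(t+3))
      + (n+1)*(A-B+n+1)*(A-g+1)/((A-B+1)*(A+2)*(A+3)) * ((t-B+1)*(t+2)*(t+3))
      = - ((n+1)*(A-g+1)*(A-B+n+1)*((t-B+1)*(t+3)*(t-B))/((A-B+1)*(A+3)*(B-A)))"
    by (rule alpha_fractions, algebra) (use nz in auto)
  \<comment> \<open>Lagrange's formula for the cubic on the right: up to sign, the numerators
    contain its values at -3, B - 1, A and B.\<close>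
  have "(g+2)*(A-n+2)*(B-n+2)*((t-B+1)*(t-A)*(t-B))/((A+3)*(B+2)*(B+3))
    + n*(B-g)*(B-A+n)*((t+3)*(t-A)*(t-B))/((A-B+1)*(B+2))
    - (n+1)*(A-g+1)*(A-B+n+1)*((t-B+1)*(t+3)*(t-B))/((A-B+1)*(A+3)*(B-A))
    + (n+1)*(B-g+1)*(B-A+n+1)*((t-A)*(t-B+1)*(t+3))/((B-A)*(B+3))
    = (t+1-g)*(t+1-A+n)*(t+1-B+n)"
    by (rule add_fractions, algebra) (use nz in auto)
  then show ?thesis
    unfolding regroup alpha beta by (simp only: times_divide_eq_left diff_conv_add_uminus add_ac)
qed

text \<open>Row 1 has only three entries. At n = 0 the cubic contains t - B + 1; removing it leaves
  Lagrange interpolation of a quadratic at -3, A and B.\<close>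

lemma first_odd_row_identity:
  fixes A B g t :: real
  assumes nz: "A+2 \<noteq> 0" "A+3 \<noteq> 0" "B+2 \<noteq> 0" "B+3 \<noteq> 0" "B-A \<noteq> 0" "A-B+1 \<noteq> 0"
  shows "(t+1-g)*(t+1-A) =
     (g+2)*(A+2)*(B+2)/((A+3)*(B+2)*(B+3)) * ((t-A)*(t-B))
   + (- ((A-g+1)*(A-B+1)*(B+2)/((B-A)*(A-B+1)*(A+2)*(A+3)))
      + (B-g+1)*(B-A+1)/((B-A)*(B+3))) * ((t-A)*(t+3))
   + (A-B+1)*(A-g+1)/((A-B+1)*(A+2)*(A+3)) * ((t+2)*(t+3))"
proof -
  have regroup: "q + (- x1+x2)*T1+y*T2 = q + (- x1*T1+y*T2) + x2*T1" for q x1 x2 y T1 T2 :: real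
    by algebra
  have alpha: "- ((A-g+1)*(A-B+1)*(B+2)/((B-A)*(A-B+1)*(A+2)*(A+3))) * ((t-A)*(t+3))
      + (A-B+1)*(A-g+1)/((A-B+1)*(A+2)*(A+3)) * ((t+2)*(t+3))
      = - ((A-g+1)*(A-B+1)*((t+3)*(t-B))/((A-B+1)*(A+3)*(B-A)))"
    by (rule alpha_fractions, algebra) (use nz in auto)
  \<comment> \<open>The zero fraction holds the place of the absent node B - 1, so that
    \<open>add_fractions\<close> applies.\<close>
  have "(g+2)*(A+2)*(B+2)*((t-A)*(t-B))/((A+3)*(B+2)*(B+3))
    + 0/((A-B+1)*(B+2))
    - (A-g+1)*(A-B+1)*((t+3)*(t-B))/((A-B+1)*(A+3)*(B-A))
    + (B-g+1)*(B-A+1)*((t-A)*(t+3))/((B-A)*(B+3))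
    = (t+1-g)*(t+1-A)"
    by (rule add_fractions, algebra) (use nz in auto)
  then show ?thesis
    unfolding regroup alpha by (simp only: times_divide_eq_left diff_conv_add_uminus add_ac div_0 add_0_left add_0_right)
qed

section \<open>Entries of the stochastic matrix\<close>

text \<open>
  Row 0 is listed separately because \<open>\<beta> + \<gamma> + 1\<close> may vanish there. In row 1 the terms with
  a factor \<open>n\<close> may have a zero denominator, and are \<open>0\<close> in any case.
\<close>

definition jacobi_pineiro_entry :: "real \<Rightarrow> real \<Rightarrow> real \<Rightarrow> nat \<Rightarrow> nat \<Rightarrow> real" where
  "jacobi_pineiro_entry \<alpha> \<beta> \<gamma> k l = (let x = real (k div 2) in
     if even k then
       if l = k + 1 then (if k = 0 then (\<gamma> + 1) / (\<alpha> + \<gamma> + 2) else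
        (\<gamma> + 2 * x + 1) * (\<alpha> + \<gamma> + 2 * x + 1) * (\<beta> + \<gamma> + 2 * x + 1) /
          ((\<alpha> + \<gamma> + 3 * x + 1) * (\<alpha> + \<gamma> + 3 * x + 2) * (\<beta> + \<gamma> + 3 * x + 1)))
       else if l = k then (if k = 0 then (\<alpha> + 1) / (\<alpha> + \<gamma> + 2) else
        (\<alpha> + x + 1) * (\<alpha> + \<gamma> + 2 * x + 1) * (\<beta> + \<gamma> + 2 * x + 1) /
          ((\<alpha> + \<gamma> + 3 * x + 1) * (\<alpha> + \<gamma> + 3 * x + 2) * (\<beta> + \<gamma> + 3 * x + 1))
        + x * (\<gamma> + 2 * x) * (\<alpha> + \<gamma> + 2 * x + 1) /
          ((\<alpha> + \<gamma> + 3 * x + 1) * (\<beta> + \<gamma> + 3 * x) * (\<beta> + \<gamma> + 3 * x + 1))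
        + x * (\<gamma> + 2 * x) * (\<beta> + \<gamma> + 2 * x) /
          ((\<alpha> + \<gamma> + 3 * x) * (\<alpha> + \<gamma> + 3 * x + 1) * (\<beta> + \<gamma> + 3 * x)))
       else if l + 1 = k then
        x * (\<alpha> - \<beta> + x) * (\<gamma> + 2 * x - 1) /
          ((\<alpha> + \<gamma> + 3 * x - 1) * (\<alpha> + \<gamma> + 3 * x) * (\<alpha> + \<gamma> + 3 * x + 1))
        + x * (\<beta> + x) * (\<beta> + \<gamma> + 2 * x) /
          ((\<alpha> + \<gamma> + 3 * x) * (\<alpha> + \<gamma> + 3 * x + 1) * (\<beta> + \<gamma> + 3 * x))
        + x * (\<beta> + x) * (\<alpha> + \<gamma> + 2 * x + 1) /
          ((\<alpha> + \<gamma> + 3 * x + 1) * (\<beta> + \<gamma> + 3 * x) * (\<beta> + \<gamma> + 3 * x + 1))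
       else if l + 2 = k then
        x * (\<alpha> - \<beta> + x) * (\<alpha> + x) /
          ((\<alpha> + \<gamma> + 3 * x - 1) * (\<alpha> + \<gamma> + 3 * x) * (\<alpha> + \<gamma> + 3 * x + 1))
       else 0
     else
       if l = k + 1 then
        (\<gamma> + 2 * x + 2) * (\<alpha> + \<gamma> + 2 * x + 2) * (\<beta> + \<gamma> + 2 * x + 2) /
          ((\<alpha> + \<gamma> + 3 * x + 3) * (\<beta> + \<gamma> + 3 * x + 2) * (\<beta> + \<gamma> + 3 * x + 3))
       else if l = k then
        - (x * (\<beta> + x) * (-\<alpha> + \<beta> + x) /
          ((\<beta> - \<alpha>) * (\<beta> + \<gamma> + 3 * x)))
        + x * (\<beta> + x) * (-\<alpha> + \<beta> + x) * (\<alpha> + \<gamma> + 3 * x + 1) /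
          ((\<beta> - \<alpha>) * (\<alpha> - \<beta> + 1) * (\<beta> + \<gamma> + 3 * x) * (\<beta> + \<gamma> + 3 * x + 1))
        - (x + 1) * (\<alpha> + x + 1) * (\<alpha> - \<beta> + x + 1) * (\<beta> + \<gamma> + 3 * x + 2) /
          ((\<beta> - \<alpha>) * (\<alpha> - \<beta> + 1) * (\<alpha> + \<gamma> + 3 * x + 2) * (\<alpha> + \<gamma> + 3 * x + 3))
        + (x + 1) * (\<beta> + x + 1) * (-\<alpha> + \<beta> + x + 1) /
          ((\<beta> - \<alpha>) * (\<beta> + \<gamma> + 3 * x + 3))
       else if l + 1 = k then
        x * (\<alpha> - \<beta> - x) * (\<beta> + x) * (\<alpha> + \<gamma> + 3 * x + 1) /
          ((\<alpha> - \<beta> + 1) * (\<beta> + \<gamma> + 3 * x) * (\<beta> + \<gamma> + 3 * x + 1) * (\<beta> + \<gamma> + 3 * x + 2))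
        + (x + 1) * (\<alpha> - \<beta> + x + 1) * (\<alpha> + x + 1) /
          ((\<alpha> - \<beta> + 1) * (\<alpha> + \<gamma> + 3 * x + 2) * (\<alpha> + \<gamma> + 3 * x + 3))
       else if l + 2 = k then
        x * (-\<alpha> + \<beta> + x) * (\<beta> + x) /
          ((\<beta> + \<gamma> + 3 * x) * (\<beta> + \<gamma> + 3 * x + 1) * (\<beta> + \<gamma> + 3 * x + 2))
       else 0)"

section \<open>Rows of the recurrence in terms of falling factorials\<close>

definition falling :: "real \<Rightarrow> nat \<Rightarrow> real \<Rightarrow> real" where
  "falling a n s = (\<Prod>j<n. s - a - real j)"

lemma falling_0: "falling a 0 s = 1"
  and falling_Suc: "falling a (Suc n) s = falling a n s * (s - a - real n)"
  by (simp_all add: falling_def)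

text \<open>The shift moves all nodes down by one: a new first factor appears and the last one drops
  out. In rows k >= 2 this leaves \<open>step_node_poly (k - 2)\<close> as a common factor of both
  sides.\<close>

lemma falling_shift: "falling a (Suc n) (s + 1) = (s + 1 - a) * falling a n s"
  unfolding falling_def prod.lessThan_Suc_shift by (simp add: algebra_simps)

context jacobi_pineiro
begin

abbreviation P :: "nat \<Rightarrow> nat \<Rightarrow> real" where "P \<equiv> jacobi_pineiro_entry \<alpha> \<beta> \<gamma>"

lemma poly_step_node_poly_even: "poly (step_node_poly (2 * n)) s = falling \<alpha> n s * falling \<beta> n s"
  by (simp add: step_node_poly_def poly_node_poly falling_def)

lemma poly_step_node_poly_odd: "poly (step_node_poly (Suc (2 * n))) s = falling \<alpha> (Suc n) s * falling \<beta> n s"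
  by (simp add: step_node_poly_def poly_node_poly falling_def)

text \<open>Writing the row index with two successors lets the lower band edge be \<open>k\<close>,
  without truncated subtraction.\<close>

lemma sum_band_row:
  "(\<Sum>l\<le>Suc (Suc (Suc k)). P (Suc (Suc k)) l * (poly (step_node_poly l) s * pochhammer (s + \<gamma> + 2 + real l) (Suc (Suc (Suc k)) - l)))
   = P (Suc (Suc k)) (Suc (Suc (Suc k))) * poly (step_node_poly (Suc (Suc (Suc k)))) s
   + P (Suc (Suc k)) (Suc (Suc k)) * (poly (step_node_poly (Suc (Suc k))) s * (s + \<gamma> + real k + 4))
   + P (Suc (Suc k)) (Suc k) * (poly (step_node_poly (Suc k)) s * ((s + \<gamma> + real k + 3) * (s + \<gamma> + real k + 4)))
   + P (Suc (Suc k)) k * (poly (step_node_poly k) s * ((s + \<gamma> + real k + 2) * (s + \<gamma> + real k + 3) * (s + \<gamma> + real k + 4)))"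
proof -
  let ?f = "\<lambda>l. P (Suc (Suc k)) l * (poly (step_node_poly l) s * pochhammer (s + \<gamma> + 2 + real l) (Suc (Suc (Suc k)) - l))"
  have "sum ?f {..Suc (Suc (Suc k))} = sum ?f {k, Suc k, Suc (Suc k), Suc (Suc (Suc k))}"
    by (rule sum.mono_neutral_right) (auto simp: jacobi_pineiro_entry_def Let_def)
  also have "\<dots> = ?f k + ?f (Suc k) + ?f (Suc (Suc k)) + ?f (Suc (Suc (Suc k)))" by simp
  also have "pochhammer (s + \<gamma> + 2 + real k) (Suc (Suc (Suc k)) - k)
      = (s + \<gamma> + real k + 2) * (s + \<gamma> + real k + 3) * (s + \<gamma> + real k + 4)"
    by (simp add: pochhammer_Suc Suc_diff_le add_ac)
  also have "pochhammer (s + \<gamma> + 2 + real (Suc k)) (Suc (Suc (Suc k)) - Suc k)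
      = (s + \<gamma> + real k + 3) * (s + \<gamma> + real k + 4)"
    by (simp add: pochhammer_Suc Suc_diff_le add_ac)
  also have "pochhammer (s + \<gamma> + 2 + real (Suc (Suc k))) (Suc (Suc (Suc k)) - Suc (Suc k))
      = s + \<gamma> + real k + 4"
    by (simp add: pochhammer_Suc Suc_diff_le add_ac)
  finally show ?thesis by (simp add: add_ac)
qed

lemma recurrence_even:
  fixes n :: nat
  defines "k \<equiv> 2 * n" and "x \<equiv> real n"
  assumes n: "n \<ge> 1"
  shows "(s + 1) * (s + 1 - \<alpha>) * (s + 1 - \<beta>) =
      P k (k + 1) * ((s - \<alpha> - x + 1) * (s - \<beta> - x + 1) * (s - \<alpha> - x))
    + P k k * ((s - \<alpha> - x + 1) * (s - \<beta> - x + 1) * (s + \<gamma> + 2 * x + 2))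
    + P k (k - 1) * ((s - \<alpha> - x + 1) * (s + \<gamma> + 2 * x + 1) * (s + \<gamma> + 2 * x + 2))
    + P k (k - 2) * ((s + \<gamma> + 2 * x) * (s + \<gamma> + 2 * x + 1) * (s + \<gamma> + 2 * x + 2))"
proof -
  have x: "x \<ge> 1" using n by (simp add: x_def)
  have nz: "\<alpha> + \<gamma> + 3 * x - 1 \<noteq> 0" "\<alpha> + \<gamma> + 3 * x \<noteq> 0" "\<alpha> + \<gamma> + 3 * x + 1 \<noteq> 0" "\<alpha> + \<gamma> + 3 * x + 2 \<noteq> 0"
      "\<beta> + \<gamma> + 3 * x \<noteq> 0" "\<beta> + \<gamma> + 3 * x + 1 \<noteq> 0"
    using x alpha beta gamma by linarith+
  have eqs: "\<alpha> + \<gamma> + 3 * x - x = \<alpha> + \<gamma> + 2 * x" "\<beta> + \<gamma> + 3 * x - x = \<beta> + \<gamma> + 2 * x"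
    "\<alpha> + \<gamma> + 3 * x - (\<gamma> + 2 * x) = \<alpha> + x" "\<beta> + \<gamma> + 3 * x - (\<gamma> + 2 * x) = \<beta> + x"
    "\<alpha> + \<gamma> + 3 * x - (\<beta> + \<gamma> + 3 * x) = \<alpha> - \<beta>"
    "s + \<gamma> + 2 * x - (\<alpha> + \<gamma> + 3 * x) = s - \<alpha> - x" "s + \<gamma> + 2 * x - (\<beta> + \<gamma> + 3 * x) = s - \<beta> - x"
    "s + \<gamma> + 2 * x + 1 - (\<gamma> + 2 * x) = s + 1"
    "s + \<gamma> + 2 * x + 1 - (\<alpha> + \<gamma> + 3 * x) + x = s + 1 - \<alpha>"
    "s + \<gamma> + 2 * x + 1 - (\<beta> + \<gamma> + 3 * x) + x = s + 1 - \<beta>"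
    by simp_all
  have k: "even k" "k \<noteq> 0" "real (k div 2) = x" "k - 1 + 1 = k" "k - 2 + 2 = k" "k - 1 \<noteq> k" "k - 2 \<noteq> k"
      "k - 1 \<noteq> k + 1" "k - 2 \<noteq> k + 1" "k - 2 + 1 \<noteq> k" "k \<noteq> k + 1"
    using n by (auto simp: k_def x_def)
  show ?thesis
    unfolding jacobi_pineiro_entry_def Let_def k(3)
    using even_row_identity[OF nz, of "s + \<gamma> + 2 * x" "\<gamma> + 2 * x" x, unfolded eqs]
    by (simp only: k not_True_eq_False if_True if_False simp_thms)
qed

lemma recurrence_odd:
  fixes n :: nat
  defines "k \<equiv> 2 * n + 1" and "x \<equiv> real n"
  assumes n: "n \<ge> 1"
  shows "(s + 1) * (s + 1 - \<alpha>) * (s + 1 - \<beta>) =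
      P k (k + 1) * ((s - \<beta> - x + 1) * (s - \<alpha> - x) * (s - \<beta> - x))
    + P k k * ((s - \<alpha> - x) * (s - \<beta> - x + 1) * (s + \<gamma> + 2 * x + 3))
    + P k (k - 1) * ((s - \<beta> - x + 1) * (s + \<gamma> + 2 * x + 2) * (s + \<gamma> + 2 * x + 3))
    + P k (k - 2) * ((s + \<gamma> + 2 * x + 1) * (s + \<gamma> + 2 * x + 2) * (s + \<gamma> + 2 * x + 3))"
proof -
  have x: "x \<ge> 1" using n by (simp add: x_def)
  \<comment> \<open>The two differences are nonzero because \<alpha> - \<beta> is nonzero and above
    -1.\<close>
  have nz: "\<alpha> + \<gamma> + 3 * x + 2 \<noteq> 0" "\<alpha> + \<gamma> + 3 * x + 3 \<noteq> 0"
      "\<beta> + \<gamma> + 3 * x + 2 \<noteq> 0" "\<beta> + \<gamma> + 3 * x + 3 \<noteq> 0"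
      "\<beta> + \<gamma> + 3 * x - (\<alpha> + \<gamma> + 3 * x) \<noteq> 0" "\<alpha> + \<gamma> + 3 * x - (\<beta> + \<gamma> + 3 * x) + 1 \<noteq> 0"
      "x = 0 \<or> \<beta> + \<gamma> + 3 * x \<noteq> 0 \<and> \<beta> + \<gamma> + 3 * x + 1 \<noteq> 0"
    using x alpha beta gamma neq close by linarith+
  have eqs: "\<alpha> + \<gamma> + 3 * x - x = \<alpha> + \<gamma> + 2 * x" "\<beta> + \<gamma> + 3 * x - x = \<beta> + \<gamma> + 2 * x"
    "\<alpha> + \<gamma> + 3 * x - (\<gamma> + 2 * x) = \<alpha> + x" "\<beta> + \<gamma> + 3 * x - (\<gamma> + 2 * x) = \<beta> + x"
    "\<alpha> + \<gamma> + 3 * x - (\<beta> + \<gamma> + 3 * x) = \<alpha> - \<beta>" "\<beta> + \<gamma> + 3 * x - (\<alpha> + \<gamma> + 3 * x) = \<beta> - \<alpha>"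
    "\<beta> - \<alpha> + x = - \<alpha> + \<beta> + x"
    "s + \<gamma> + 2 * x - (\<alpha> + \<gamma> + 3 * x) = s - \<alpha> - x" "s + \<gamma> + 2 * x - (\<beta> + \<gamma> + 3 * x) = s - \<beta> - x"
    "s + \<gamma> + 2 * x + 1 - (\<gamma> + 2 * x) = s + 1"
    "s + \<gamma> + 2 * x + 1 - (\<alpha> + \<gamma> + 3 * x) + x = s + 1 - \<alpha>"
    "s + \<gamma> + 2 * x + 1 - (\<beta> + \<gamma> + 3 * x) + x = s + 1 - \<beta>"
    by simp_all
  have k: "\<not> even k" "real (k div 2) = x" "k - 1 + 1 = k" "k - 2 + 2 = k" "k - 1 \<noteq> k" "k - 2 \<noteq> k"
      "k - 1 \<noteq> k + 1" "k - 2 \<noteq> k + 1" "k - 2 + 1 \<noteq> k" "k \<noteq> k + 1"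
    using n by (auto simp: k_def x_def)
  show ?thesis
    unfolding jacobi_pineiro_entry_def Let_def k(2)
    using odd_row_identity[OF nz, of "s + \<gamma> + 2 * x" "\<gamma> + 2 * x", unfolded eqs]
    by (simp only: k not_True_eq_False if_True if_False simp_thms)
qed

text \<open>From row 2 on, removing the common factor leaves a cubic identity. Rows 0 and 1 are cut
  off at the left border and are checked separately.\<close>

lemma recurrence:
  "(s + 1) * poly (step_node_poly k) (s + 1) =
    (\<Sum>l\<le>Suc k. P k l * (poly (step_node_poly l) s * pochhammer (s + \<gamma> + 2 + real l) (Suc k - l)))"
proof -
  have regroup: "(p1 * x1 + p2 * (x2 * c2) + p3 * (x3 * c3) + p4 * c4) * F
    = p1 * (F * x1) + p2 * (F * x2 * c2) + p3 * (F * x3 * c3) + p4 * (F * c4)"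
    for p1 p2 p3 p4 x1 x2 x3 c2 c3 c4 F :: real
    by algebra
  consider "k = 0" | "k = 1" | n where "k = 2 * Suc n" | n where "k = Suc (2 * Suc n)"
    by (metis One_nat_def Suc_eq_plus1 evenE oddE not0_implies_Suc mult_0_right)
  then show ?thesis
  proof cases
    case 1
    have "\<alpha> + \<gamma> + 2 \<noteq> 0" using alpha gamma by linarith
    \<comment> \<open>Linear interpolation of s + 1 at the points \<alpha> and -\<gamma> -
      2.\<close>
    moreover have "(\<gamma> + 1) * (s - \<alpha>) + (\<alpha> + 1) * (s + \<gamma> + 2) = (s + 1) * (\<alpha> + \<gamma> + 2)"
      by algebra
    ultimately have "s + 1 = (\<gamma> + 1) / (\<alpha> + \<gamma> + 2) * (s - \<alpha>) + (\<alpha> + 1) / (\<alpha> + \<gamma> + 2) * (s + \<gamma> + 2)"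
      by (simp only: times_divide_eq_left flip: add_divide_distrib) simp
    then show ?thesis using 1
      by (simp add: jacobi_pineiro_entry_def step_node_poly_def poly_node_poly add_ac)
  next
    case 2
    have nz: "\<alpha> + \<gamma> + 2 \<noteq> 0" "\<alpha> + \<gamma> + 3 \<noteq> 0" "\<beta> + \<gamma> + 2 \<noteq> 0" "\<beta> + \<gamma> + 3 \<noteq> 0"
      "\<beta> + \<gamma> - (\<alpha> + \<gamma>) \<noteq> 0" "\<alpha> + \<gamma> - (\<beta> + \<gamma>) + 1 \<noteq> 0"
      using alpha beta gamma neq close by linarith+
    have eqs: "\<alpha> + \<gamma> - (\<beta> + \<gamma>) = \<alpha> - \<beta>" "\<beta> + \<gamma> - (\<alpha> + \<gamma>) = \<beta> - \<alpha>"
      "\<alpha> + \<gamma> - \<gamma> = \<alpha>" "\<beta> + \<gamma> - \<gamma> = \<beta>" "s + \<gamma> + 1 - \<gamma> = s + 1" "s + \<gamma> + 1 - (\<alpha> + \<gamma>) = s + 1 - \<alpha>"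
      "s + \<gamma> - (\<alpha> + \<gamma>) = s - \<alpha>" "s + \<gamma> - (\<beta> + \<gamma>) = s - \<beta>" "\<beta> - \<alpha> + 1 = - \<alpha> + \<beta> + 1"
      by simp_all
    have nodes: "poly (step_node_poly 0) s = 1" "poly (step_node_poly (Suc 0)) s = s - \<alpha>"
      "poly (step_node_poly (Suc (Suc 0))) s = (s - \<alpha>) * (s - \<beta>)"
      using poly_step_node_poly_even[of 0 s] poly_step_node_poly_odd[of 0 s] poly_step_node_poly_even[of 1 s]
      by (simp_all add: falling_0 falling_Suc numeral_2_eq_2)
    have "(s + 1) * (s + 1 - \<alpha>) =
        P 1 2 * ((s - \<alpha>) * (s - \<beta>)) + P 1 1 * ((s - \<alpha>) * (s + \<gamma> + 3)) + P 1 0 * ((s + \<gamma> + 2) * (s + \<gamma> + 3))"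
      using first_odd_row_identity[OF nz, of "s + \<gamma>" "\<gamma>", unfolded eqs] by (simp add: jacobi_pineiro_entry_def)
    also have "\<dots> = (\<Sum>l\<le>Suc k. P k l * (poly (step_node_poly l) s * pochhammer (s + \<gamma> + 2 + real l) (Suc k - l)))"
      unfolding 2 One_nat_def by (simp add: nodes numeral_2_eq_2 pochhammer_Suc add_ac)
    finally show ?thesis unfolding 2 by (simp add: step_node_poly_def poly_node_poly)
  next
    case 3
    \<comment> \<open>This is the node polynomial of index k - 2, with k = 2n + 2; the case variable
      is one less than the index in \<open>recurrence_even\<close>.\<close>
    let ?F = "falling \<alpha> n s * falling \<beta> n s"
    have k: "k = Suc (Suc (2 * n))" using 3 by simp
    have nodes: "poly (step_node_poly (2 * n)) s = ?F"
      "poly (step_node_poly (Suc (2 * n))) s = ?F * (s - \<alpha> - real n)"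
      "poly (step_node_poly (Suc (Suc (2 * n)))) s = ?F * ((s - \<alpha> - real n) * (s - \<beta> - real n))"
      "poly (step_node_poly (Suc (Suc (Suc (2 * n))))) s = ?F * ((s - \<alpha> - real n) * (s - \<beta> - real n) * (s - \<alpha> - real n - 1))"
      using poly_step_node_poly_even[of n s] poly_step_node_poly_odd[of n s]
        poly_step_node_poly_even[of "Suc n" s] poly_step_node_poly_odd[of "Suc n" s]
      by (simp_all add: falling_Suc diff_diff_eq add_ac)
    have "(s + 1) * poly (step_node_poly k) (s + 1) = ((s + 1) * (s + 1 - \<alpha>) * (s + 1 - \<beta>)) * ?F"
      unfolding 3 poly_step_node_poly_even falling_shift by simp
    also have "(s + 1) * (s + 1 - \<alpha>) * (s + 1 - \<beta>) =
        P k (Suc (Suc (Suc (2 * n)))) * ((s - \<alpha> - real n) * (s - \<beta> - real n) * (s - \<alpha> - real n - 1))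
      + P k (Suc (Suc (2 * n))) * ((s - \<alpha> - real n) * (s - \<beta> - real n) * (s + \<gamma> + real (2 * n) + 4))
      + P k (Suc (2 * n)) * ((s - \<alpha> - real n) * ((s + \<gamma> + real (2 * n) + 3) * (s + \<gamma> + real (2 * n) + 4)))
      + P k (2 * n) * ((s + \<gamma> + real (2 * n) + 2) * (s + \<gamma> + real (2 * n) + 3) * (s + \<gamma> + real (2 * n) + 4))"
      using recurrence_even[of "Suc n" s] by (simp add: k algebra_simps)
    finally show ?thesis
      unfolding k sum_band_row nodes by (simp only: regroup)
  next
    case 4
    let ?F = "falling \<alpha> (Suc n) s * falling \<beta> n s"
    have k: "k = Suc (Suc (Suc (2 * n)))" using 4 by simp
    have nodes: "poly (step_node_poly (Suc (2 * n))) s = ?F"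
      "poly (step_node_poly (Suc (Suc (2 * n)))) s = ?F * (s - \<beta> - real n)"
      "poly (step_node_poly (Suc (Suc (Suc (2 * n))))) s = ?F * ((s - \<alpha> - real n - 1) * (s - \<beta> - real n))"
      "poly (step_node_poly (Suc (Suc (Suc (Suc (2 * n)))))) s = ?F * ((s - \<beta> - real n) * (s - \<alpha> - real n - 1) * (s - \<beta> - real n - 1))"
      using poly_step_node_poly_odd[of n s] poly_step_node_poly_even[of "Suc n" s]
        poly_step_node_poly_odd[of "Suc n" s] poly_step_node_poly_even[of "Suc (Suc n)" s]
      by (simp_all add: falling_Suc diff_diff_eq add_ac)
    have "(s + 1) * poly (step_node_poly k) (s + 1) = ((s + 1) * (s + 1 - \<alpha>) * (s + 1 - \<beta>)) * ?F"
      unfolding 4 poly_step_node_poly_odd falling_shift by simp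
    also have "(s + 1) * (s + 1 - \<alpha>) * (s + 1 - \<beta>) =
        P k (Suc (Suc (Suc (Suc (2 * n))))) * ((s - \<beta> - real n) * (s - \<alpha> - real n - 1) * (s - \<beta> - real n - 1))
      + P k (Suc (Suc (Suc (2 * n)))) * ((s - \<alpha> - real n - 1) * (s - \<beta> - real n) * (s + \<gamma> + real (Suc (2 * n)) + 4))
      + P k (Suc (Suc (2 * n))) * ((s - \<beta> - real n) * ((s + \<gamma> + real (Suc (2 * n)) + 3) * (s + \<gamma> + real (Suc (2 * n)) + 4)))
      + P k (Suc (2 * n)) * ((s + \<gamma> + real (Suc (2 * n)) + 2) * (s + \<gamma> + real (Suc (2 * n)) + 3) * (s + \<gamma> + real (Suc (2 * n)) + 4))"
      using recurrence_odd[of "Suc n" s] by (simp add: k algebra_simps)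
    finally show ?thesis
      unfolding k sum_band_row nodes by (simp only: regroup)
  qed
qed

lemma stochastic_matrix_II_eq: "stochastic_matrix_II \<alpha> \<beta> \<gamma> = P"
  by (rule stochastic_matrix_II_eqI[OF _ recurrence[unfolded Suc_eq_plus1]]) (auto simp: jacobi_pineiro_entry_def Let_def)

end

theorem corollary7:
  fixes \<alpha> \<beta> \<gamma> :: real
  assumes "\<alpha> > -1" and "\<beta> > -1" and "\<gamma> > -1"
    and "\<alpha> \<noteq> \<beta>" and "\<bar>\<alpha> - \<beta>\<bar> < 1"
  shows
    "(\<forall>n. stochastic_matrix_II \<alpha> \<beta> \<gamma> (2 * n) (2 * n + 1) =
        (if n = 0 then (\<gamma> + 1) / (\<alpha> + \<gamma> + 2) else
        (\<gamma> + 2 * real n + 1) * (\<alpha> + \<gamma> + 2 * real n + 1) * (\<beta> + \<gamma> + 2 * real n + 1) /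
          ((\<alpha> + \<gamma> + 3 * real n + 1) * (\<alpha> + \<gamma> + 3 * real n + 2) * (\<beta> + \<gamma> + 3 * real n + 1)))) \<and>
    (\<forall>n. stochastic_matrix_II \<alpha> \<beta> \<gamma> (2 * n + 1) (2 * n + 2) =
        (\<gamma> + 2 * real n + 2) * (\<alpha> + \<gamma> + 2 * real n + 2) * (\<beta> + \<gamma> + 2 * real n + 2) /
          ((\<alpha> + \<gamma> + 3 * real n + 3) * (\<beta> + \<gamma> + 3 * real n + 2) * (\<beta> + \<gamma> + 3 * real n + 3))) \<and>
    (\<forall>n. stochastic_matrix_II \<alpha> \<beta> \<gamma> (2 * n) (2 * n) =
        (if n = 0 then (\<alpha> + 1) / (\<alpha> + \<gamma> + 2) else
        (\<alpha> + real n + 1) * (\<alpha> + \<gamma> + 2 * real n + 1) * (\<beta> + \<gamma> + 2 * real n + 1) /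
          ((\<alpha> + \<gamma> + 3 * real n + 1) * (\<alpha> + \<gamma> + 3 * real n + 2) * (\<beta> + \<gamma> + 3 * real n + 1))
        + real n * (\<gamma> + 2 * real n) * (\<alpha> + \<gamma> + 2 * real n + 1) /
          ((\<alpha> + \<gamma> + 3 * real n + 1) * (\<beta> + \<gamma> + 3 * real n) * (\<beta> + \<gamma> + 3 * real n + 1))
        + real n * (\<gamma> + 2 * real n) * (\<beta> + \<gamma> + 2 * real n) /
          ((\<alpha> + \<gamma> + 3 * real n) * (\<alpha> + \<gamma> + 3 * real n + 1) * (\<beta> + \<gamma> + 3 * real n)))) \<and>
    (\<forall>n. stochastic_matrix_II \<alpha> \<beta> \<gamma> (2 * n + 1) (2 * n + 1) =
        - (real n * (\<beta> + real n) * (-\<alpha> + \<beta> + real n) /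
          ((\<beta> - \<alpha>) * (\<beta> + \<gamma> + 3 * real n)))
        + real n * (\<beta> + real n) * (-\<alpha> + \<beta> + real n) * (\<alpha> + \<gamma> + 3 * real n + 1) /
          ((\<beta> - \<alpha>) * (\<alpha> - \<beta> + 1) * (\<beta> + \<gamma> + 3 * real n) * (\<beta> + \<gamma> + 3 * real n + 1))
        - (real n + 1) * (\<alpha> + real n + 1) * (\<alpha> - \<beta> + real n + 1) * (\<beta> + \<gamma> + 3 * real n + 2) /
          ((\<beta> - \<alpha>) * (\<alpha> - \<beta> + 1) * (\<alpha> + \<gamma> + 3 * real n + 2) * (\<alpha> + \<gamma> + 3 * real n + 3))
        + (real n + 1) * (\<beta> + real n + 1) * (-\<alpha> + \<beta> + real n + 1) /
          ((\<beta> - \<alpha>) * (\<beta> + \<gamma> + 3 * real n + 3))) \<and>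
    (\<forall>n. stochastic_matrix_II \<alpha> \<beta> \<gamma> (2 * n + 1) (2 * n) =
        real n * (\<alpha> - \<beta> - real n) * (\<beta> + real n) * (\<alpha> + \<gamma> + 3 * real n + 1) /
          ((\<alpha> - \<beta> + 1) * (\<beta> + \<gamma> + 3 * real n) * (\<beta> + \<gamma> + 3 * real n + 1) * (\<beta> + \<gamma> + 3 * real n + 2))
        + (real n + 1) * (\<alpha> - \<beta> + real n + 1) * (\<alpha> + real n + 1) /
          ((\<alpha> - \<beta> + 1) * (\<alpha> + \<gamma> + 3 * real n + 2) * (\<alpha> + \<gamma> + 3 * real n + 3))) \<and>
    (\<forall>n\<ge>1. stochastic_matrix_II \<alpha> \<beta> \<gamma> (2 * n) (2 * n - 1) =
        real n * (\<alpha> - \<beta> + real n) * (\<gamma> + 2 * real n - 1) /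
          ((\<alpha> + \<gamma> + 3 * real n - 1) * (\<alpha> + \<gamma> + 3 * real n) * (\<alpha> + \<gamma> + 3 * real n + 1))
        + real n * (\<beta> + real n) * (\<beta> + \<gamma> + 2 * real n) /
          ((\<alpha> + \<gamma> + 3 * real n) * (\<alpha> + \<gamma> + 3 * real n + 1) * (\<beta> + \<gamma> + 3 * real n))
        + real n * (\<beta> + real n) * (\<alpha> + \<gamma> + 2 * real n + 1) /
          ((\<alpha> + \<gamma> + 3 * real n + 1) * (\<beta> + \<gamma> + 3 * real n) * (\<beta> + \<gamma> + 3 * real n + 1))) \<and>
    (\<forall>n\<ge>1. stochastic_matrix_II \<alpha> \<beta> \<gamma> (2 * n) (2 * n - 2) =
        real n * (\<alpha> - \<beta> + real n) * (\<alpha> + real n) /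
          ((\<alpha> + \<gamma> + 3 * real n - 1) * (\<alpha> + \<gamma> + 3 * real n) * (\<alpha> + \<gamma> + 3 * real n + 1))) \<and>
    (\<forall>n\<ge>1. stochastic_matrix_II \<alpha> \<beta> \<gamma> (2 * n + 1) (2 * n - 1) =
        real n * (-\<alpha> + \<beta> + real n) * (\<beta> + real n) /
          ((\<beta> + \<gamma> + 3 * real n) * (\<beta> + \<gamma> + 3 * real n + 1) * (\<beta> + \<gamma> + 3 * real n + 2)))"
proof -
  interpret jacobi_pineiro \<alpha> \<beta> \<gamma> by standard (use assms in auto)
  show ?thesis
    unfolding stochastic_matrix_II_eq
    by (intro conjI allI impI) (auto simp: jacobi_pineiro_entry_def Let_def)
qed

end
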